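(* Let $F>0$, let $N\ge 1$ be an integer and $\epsilon=1/N$. Suppose that $$\phi''_{F}>0,\ \phi''_{2F}<0,\quad \rho'_{F}\le 0,\ \rho'_{2F}\le 0,\quad \rho''_{F}\ge 0,\ \rho''_{2F}\ge 0,\quad G''_{F}\ge 0.$$ Then the uniform deformation $\mathbf{y}_F$ is stable in the volume-based local model, i.e. $\langle\delta^2\mathcal{E}^{c,v}(\mathbf{y}_F)\mathbf{u},\mathbf{u}\rangle>0$ for all $\mathbf{u}\in\mathcal{U}\setminus\{\mathbf{0}\}$, if and only if $$A_F:=4G''_F(\rho'_F+2\rho'_{2F})^2+2G'_F(\rho''_F+4\rho''_{2F})+\phi''_F+4\phi''_{2F}>0.$$
   Context: Fix smooth functions $\phi,\rho:(0,\infty)\to\mathbb{R}$ (pair potential, electron density) and $G:\mathbb{R}\to\mathbb{R}$ (embedding function), $F>0$, an integer $N\ge1$, and $\epsilon=1/N$. Let $\mathcal{U}$ be the space of real sequences $\mathbf{u}=(u_\ell)_{\ell\in\mathbb{Z}}$ with $u_{\ell+2N}=u_\ell$ and $\sum_{\ell=-N+1}^N u_\ell=0$. Let $(\mathbf{y}_F)_\ell=F\epsilon\ell$ and $\mathcal{Y}_F=\{\mathbf{y}_F+\mathbf{u}:\mathbf{u}\in\mathcal{U}\}$. For a sequence $\mathbf{y}$ put $y'_\ell=(y_\ell-y_{\ell-1})/\epsilon$. Volume-based local (Cauchy--Born) EAM energy: for $\mathbf{y}\in\mathcal{Y}_F$ (near $\mathbf{y}_F$), $$\mathcal{E}^{c,v}(\mathbf{y})=\epsilon\sum_{\ell=-N+1}^N\Big\{\tfrac12G\big(\bar\rho^{c,v}_\ell(\mathbf{y})\big)+\tfrac12G\big(\bar\rho^{c,v}_{\ell+1}(\mathbf{y})\big)+\tfrac12\big[\phi(y'_\ell)+\phi(2y'_\ell)+\phi(y'_{\ell+1})+\phi(2y'_{\ell+1})\big]\Big\},$$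 $$\bar\rho^{c,v}_\ell(\mathbf{y})=2\rho(y'_\ell)+2\rho(2y'_\ell).$$ The second variation is the quadratic form $\langle\delta^2\mathcal{E}^{c,v}(\mathbf{y}_F)\mathbf{u},\mathbf{u}\rangle=\frac{d^2}{dt^2}\mathcal{E}^{c,v}(\mathbf{y}_F+t\mathbf{u})\big|_{t=0}$ for $\mathbf{u}\in\mathcal{U}$. Notation: $\phi''_F=\phi''(F)$, $\phi''_{2F}=\phi''(2F)$, $\rho'_F=\rho'(F)$, $\rho'_{2F}=\rho'(2F)$, $\rho''_F=\rho''(F)$, $\rho''_{2F}=\rho''(2F)$, and $G'_F=G'(\bar\rho_F)$, $G''_F=G''(\bar\rho_F)$ with $\bar\rho_F=2\rho(F)+2\rho(2F)$. *)

theory Defs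
  imports "HOL-Analysis.Analysis"
begin

text \<open>
  \<open>S\<close> is meant to be open, so that the iterated \<^const>\<open>deriv\<close> depends only on the
  values of \<open>f\<close> on \<open>S\<close>.
\<close>

definition smooth_on :: "real set \<Rightarrow> (real \<Rightarrow> real) \<Rightarrow> bool" where
  "smooth_on S f \<longleftrightarrow> (\<forall>k. \<forall>x\<in>S. (deriv ^^ k) f field_differentiable (at x))"

definition eps :: "nat \<Rightarrow> real" where
  "eps N = 1 / real N"

definition displacements :: "nat \<Rightarrow> (int \<Rightarrow> real) set" where
  "displacements N =
     {u. (\<forall>l. u (l + 2 * int N) = u l) \<and> (\<Sum>l = - int N + 1..int N. u l) = 0}"

definition y_unif :: "nat \<Rightarrow> real \<Rightarrow> int \<Rightarrow> real" where
  "y_unif N F l = F * eps N * of_int l"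

definition bdiff :: "nat \<Rightarrow> (int \<Rightarrow> real) \<Rightarrow> int \<Rightarrow> real" where
  "bdiff N y l = (y l - y (l - 1)) / eps N"

text \<open>
  The potentials \<open>\<phi>\<close> and \<open>\<rho>\<close> have domain \<open>(0,\<infinity>)\<close>.  They are total functions here, so the
  energy below is meaningful only at deformations all of whose backward differences are
  positive; this includes all deformations in \<open>\<Y>\<^sub>F\<close> sufficiently close to \<open>y\<^sub>F\<close>.
\<close>

definition rho_bar_cv :: "(real \<Rightarrow> real) \<Rightarrow> nat \<Rightarrow> (int \<Rightarrow> real) \<Rightarrow> int \<Rightarrow> real" where
  "rho_bar_cv \<rho> N y l = 2 * \<rho> (bdiff N y l) + 2 * \<rho> (2 * bdiff N y l)"

definition energy_cv ::
  "(real \<Rightarrow> real) \<Rightarrow> (real \<Rightarrow> real) \<Rightarrow> (real \<Rightarrow> real) \<Rightarrow> nat \<Rightarrow> (int \<Rightarrow> real) \<Rightarrow> real" where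
  "energy_cv \<phi> \<rho> G N y =
     eps N * (\<Sum>l = - int N + 1..int N.
       1/2 * G (rho_bar_cv \<rho> N y l) + 1/2 * G (rho_bar_cv \<rho> N y (l + 1))
       + 1/2 * (\<phi> (bdiff N y l) + \<phi> (2 * bdiff N y l)
                + \<phi> (bdiff N y (l + 1)) + \<phi> (2 * bdiff N y (l + 1))))"

text \<open>The quadratic form \<open>\<langle>\<delta>\<^sup>2E(y)u,u\<rangle>\<close>.\<close>

definition second_variation ::
  "((int \<Rightarrow> real) \<Rightarrow> real) \<Rightarrow> (int \<Rightarrow> real) \<Rightarrow> (int \<Rightarrow> real) \<Rightarrow> real" where
  "second_variation E y u = (deriv ^^ 2) (\<lambda>t. E (\<lambda>l. y l + t * u l)) 0"

definition rho_bar_unif :: "(real \<Rightarrow> real) \<Rightarrow> real \<Rightarrow> real" where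
  "rho_bar_unif \<rho> F = 2 * \<rho> F + 2 * \<rho> (2 * F)"

definition A_coeff ::
  "(real \<Rightarrow> real) \<Rightarrow> (real \<Rightarrow> real) \<Rightarrow> (real \<Rightarrow> real) \<Rightarrow> real \<Rightarrow> real" where
  "A_coeff \<phi> \<rho> G F =
     4 * (deriv ^^ 2) G (rho_bar_unif \<rho> F) * (deriv \<rho> F + 2 * deriv \<rho> (2 * F))^2
     + 2 * deriv G (rho_bar_unif \<rho> F) * ((deriv ^^ 2) \<rho> F + 4 * (deriv ^^ 2) \<rho> (2 * F))
     + (deriv ^^ 2) \<phi> F + 4 * (deriv ^^ 2) \<phi> (2 * F)"

end

theory Submission
  imports Defs
begin

text \<open>
  Periodicity turns the energy into \<open>\<epsilon> \<Sum>\<^sub>\<ell> W (y'\<^sub>\<ell>)\<close> for the Cauchy--Born energy density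
  \<open>W s = G (2 \<rho> s + 2 \<rho> (2 s)) + \<phi> s + \<phi> (2 s)\<close>.  As \<open>y\<^sub>F\<close> has constant gradient \<open>F\<close>, the second
  variation is \<open>\<epsilon> W'' F \<Sum>\<^sub>\<ell> (u'\<^sub>\<ell>)\<^sup>2\<close>, and \<open>W'' F\<close> is exactly \<open>A\<^sub>F\<close>.  The sum is positive for nonzero
  \<open>u\<close>, because a displacement with vanishing gradient is constant and has mean zero; the
  alternating displacement \<open>(-1)\<^sup>\<ell>\<close> shows that nonzero displacements exist for every \<open>N \<ge> 1\<close>.
\<close>

lemma smooth_on_has_deriv:
  assumes "smooth_on S f" "x \<in> S"
  shows "(f has_real_derivative deriv f x) (at x)"
    and "(deriv f has_real_derivative (deriv ^^ 2) f x) (at x)"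
proof -
  have "(deriv ^^ k) f field_differentiable at x" for k
    using assms unfolding smooth_on_def by blast
  from this[of 0] this[of 1] show "(f has_real_derivative deriv f x) (at x)"
    and "(deriv f has_real_derivative (deriv ^^ 2) f x) (at x)"
    by (simp_all add: numeral_2_eq_2 field_differentiable_derivI)
qed

text \<open>An outer derivative at 0 sees only the germ of the inner one, so a formula for
  \<open>W'\<close> on an open neighbourhood \<open>S\<close> of \<open>x\<close> is enough. This
  matters because \<open>\<phi>\<close> and \<open>\<rho>\<close> are controlled only on the
  positive half-line. Finiteness of \<open>I\<close> gives one neighbourhood of 0 that serves all
  indices.\<close>

lemma deriv2_sum_affine:
  fixes W W1 :: "real \<Rightarrow> real" and c :: "'i \<Rightarrow> real"
  assumes "finite I" "open S" "x \<in> S"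
    and W: "\<And>s. s \<in> S \<Longrightarrow> (W has_real_derivative W1 s) (at s)"
    and W1: "(W1 has_real_derivative A) (at x)"
  shows "(deriv ^^ 2) (\<lambda>t. k * (\<Sum>i\<in>I. W (x + t * c i))) 0 = k * A * (\<Sum>i\<in>I. (c i)\<^sup>2)"
proof -
  have "eventually (\<lambda>t. x + t * c i \<in> S) (nhds 0)" for i
  proof -
    have "((\<lambda>t. x + t * c i) \<longlongrightarrow> x + 0 * c i) (nhds 0)"
      by (intro tendsto_intros filterlim_ident)
    then show ?thesis
      using topological_tendstoD[of _ x "nhds 0" S] assms(2,3) by simp
  qed
  then have "eventually (\<lambda>t. \<forall>i\<in>I. x + t * c i \<in> S) (nhds 0)"
    using assms(1) by (simp add: eventually_ball_finite)
  then have "eventually (\<lambda>t. deriv (\<lambda>t. k * (\<Sum>i\<in>I. W (x + t * c i))) t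
      = k * (\<Sum>i\<in>I. W1 (x + t * c i) * c i)) (nhds 0)"
  proof eventually_elim
    case (elim t)
    have "((\<lambda>t. W (x + t * c i)) has_real_derivative W1 (x + t * c i) * c i) (at t)"
      if "i \<in> I" for i
    proof (rule DERIV_chain2[where f = W])
      show "(W has_real_derivative W1 (x + t * c i)) (at (x + t * c i))"
        using elim that W by blast
    qed (auto intro!: derivative_eq_intros)
    then show ?case
      by (intro DERIV_imp_deriv DERIV_cmult DERIV_sum)
  qed
  then have "(deriv ^^ 2) (\<lambda>t. k * (\<Sum>i\<in>I. W (x + t * c i))) 0
      = deriv (\<lambda>t. k * (\<Sum>i\<in>I. W1 (x + t * c i) * c i)) 0"
    by (simp add: numeral_2_eq_2 deriv_cong_ev)
  also have "\<dots> = k * (\<Sum>i\<in>I. A * c i * c i)"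
  proof (intro DERIV_imp_deriv DERIV_cmult DERIV_sum DERIV_cmult_right)
    show "((\<lambda>t. W1 (x + t * c i)) has_real_derivative A * c i) (at 0)" for i
      by (rule DERIV_chain2[where f = W1]) (use W1 in \<open>auto intro!: derivative_eq_intros\<close>)
  qed
  finally show ?thesis
    by (simp add: sum_distrib_left power2_eq_square mult.assoc)
qed

text \<open>The shifted window gains \<open>N + 1\<close> and loses \<open>- N + 1\<close>; these
  indices differ by exactly one period.\<close>

lemma sum_period_shift:
  fixes f :: "int \<Rightarrow> real"
  assumes "\<And>l. f (l + 2 * int N) = f l"
  shows "(\<Sum>l = - int N + 1..int N. f (l + 1)) = (\<Sum>l = - int N + 1..int N. f l)"
\<comment> \<open>For \<open>N = 0\<close> both windows are empty, and an end point could not be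
  split off.\<close>
proof (cases "N = 0")
  case False
  have "(\<Sum>l = - int N + 1..int N. f (l + 1)) = (\<Sum>l = - int N + 2..int N + 1. f l)"
    by (rule sum.reindex_bij_witness[of _ "\<lambda>l. l - 1" "\<lambda>l. l + 1"]) auto
  also have "{- int N + 2..int N + 1} = insert (int N + 1) {- int N + 2..int N}"
    using False by auto
  also have "sum f \<dots> = f (int N + 1) + (\<Sum>l = - int N + 2..int N. f l)"
    by simp
  also have "f (int N + 1) = f (- int N + 1)"
    using assms[of "- int N + 1"] by (simp add: algebra_simps)
  also have "f (- int N + 1) + (\<Sum>l = - int N + 2..int N. f l)
      = sum f (insert (- int N + 1) {- int N + 2..int N})"
    by simp
  also have "insert (- int N + 1) {- int N + 2..int N} = {- int N + 1..int N}"
    using False by auto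
  finally show ?thesis .
qed simp

definition density_cv ::
  "(real \<Rightarrow> real) \<Rightarrow> (real \<Rightarrow> real) \<Rightarrow> (real \<Rightarrow> real) \<Rightarrow> real \<Rightarrow> real" where
  "density_cv \<phi> \<rho> G s = G (rho_bar_unif \<rho> s) + \<phi> s + \<phi> (2 * s)"

lemma bdiff_periodic:
  assumes "\<And>l. u (l + 2 * int N) = u l"
  shows "bdiff N u (l + 2 * int N) = bdiff N u l"
  using assms[of l] assms[of "l - 1"] by (simp add: bdiff_def algebra_simps)

lemma bdiff_y_unif_add:
  assumes "N \<ge> 1"
  shows "bdiff N (\<lambda>l. y_unif N F l + t * u l) l = F + t * bdiff N u l"
  using assms by (simp add: bdiff_def y_unif_def eps_def field_simps)

text \<open>Each site carries half the density at \<open>l\<close> and half at \<open>l + 1\<close>;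
  by periodicity both halves have the same sum.\<close>

lemma energy_cv_y_unif_add:
  assumes "N \<ge> 1" and per: "\<And>l. u (l + 2 * int N) = u l"
  shows "energy_cv \<phi> \<rho> G N (\<lambda>l. y_unif N F l + t * u l)
    = eps N * (\<Sum>l = - int N + 1..int N. density_cv \<phi> \<rho> G (F + t * bdiff N u l))"
proof -
  define w where "w l = density_cv \<phi> \<rho> G (F + t * bdiff N u l)" for l
  have "w (l + 2 * int N) = w l" for l
    using bdiff_periodic[of u N l] per by (simp add: w_def)
  then have "(\<Sum>l = - int N + 1..int N. w (l + 1)) = (\<Sum>l = - int N + 1..int N. w l)"
    by (rule sum_period_shift)
  then have "(\<Sum>l = - int N + 1..int N. (w l + w (l + 1)) / 2) = (\<Sum>l = - int N + 1..int N. w l)"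
    by (simp add: sum.distrib flip: sum_divide_distrib)
  moreover have "energy_cv \<phi> \<rho> G N (\<lambda>l. y_unif N F l + t * u l)
      = eps N * (\<Sum>l = - int N + 1..int N. (w l + w (l + 1)) / 2)"
    unfolding energy_cv_def rho_bar_cv_def bdiff_y_unif_add[OF assms(1)]
    by (intro arg_cong2[where f = "(*)"] sum.cong)
      (auto simp: w_def density_cv_def rho_bar_unif_def field_simps)
  ultimately show ?thesis
    by (simp add: w_def)
qed

lemma second_variation_energy_cv:
  fixes \<phi> \<rho> G :: "real \<Rightarrow> real"
  assumes \<phi>: "smooth_on {0<..} \<phi>" and \<rho>: "smooth_on {0<..} \<rho>" and G: "smooth_on UNIV G"
    and "F > 0" "N \<ge> 1" and "u \<in> displacements N"
  shows "second_variation (energy_cv \<phi> \<rho> G N) (y_unif N F) u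
    = eps N * A_coeff \<phi> \<rho> G F * (\<Sum>l = - int N + 1..int N. (bdiff N u l)\<^sup>2)"
proof -
  \<comment> \<open>\<open>R1\<close> and \<open>W1\<close> are the first derivatives of
    \<open>rho_bar_unif \<rho>\<close> and of the density at positive arguments.\<close>
  define R1 where "R1 s = 2 * deriv \<rho> s + 4 * deriv \<rho> (2 * s)" for s
  define W1 where
    "W1 s = deriv G (rho_bar_unif \<rho> s) * R1 s + deriv \<phi> s + 2 * deriv \<phi> (2 * s)" for s
  have double: "((\<lambda>s. f (2 * s)) has_real_derivative 2 * d) (at s)"
    if "(f has_real_derivative d) (at (2 * s))" for f d and s :: real
  proof -
    have "((\<lambda>s. f (2 * s)) has_real_derivative d * 2) (at s)"
      by (rule DERIV_chain2[where f = f and g = "\<lambda>s. 2 * s", OF that])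
        (auto intro!: derivative_eq_intros)
    then show ?thesis
      by (rule DERIV_cong) simp
  qed
  have R: "(rho_bar_unif \<rho> has_real_derivative R1 s) (at s)" if "s > 0" for s
  proof -
    have "((\<lambda>s. 2 * \<rho> s + 2 * \<rho> (2 * s)) has_real_derivative
        2 * deriv \<rho> s + 2 * (2 * deriv \<rho> (2 * s))) (at s)"
      using that by (intro DERIV_add DERIV_cmult double smooth_on_has_deriv(1)[OF \<rho>]) auto
    then show ?thesis
      by (simp add: rho_bar_unif_def[abs_def] R1_def)
  qed
  have R1: "(R1 has_real_derivative 2 * (deriv ^^ 2) \<rho> s + 8 * (deriv ^^ 2) \<rho> (2 * s)) (at s)"
    if "s > 0" for s
  proof -
    have "((\<lambda>s. 2 * deriv \<rho> s + 4 * deriv \<rho> (2 * s)) has_real_derivative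
        2 * (deriv ^^ 2) \<rho> s + 4 * (2 * (deriv ^^ 2) \<rho> (2 * s))) (at s)"
      using that by (intro DERIV_add DERIV_cmult double smooth_on_has_deriv(2)[OF \<rho>]) auto
    then show ?thesis
      by (simp add: R1_def[abs_def])
  qed
  have GR: "((\<lambda>s. G (rho_bar_unif \<rho> s)) has_real_derivative
      deriv G (rho_bar_unif \<rho> s) * R1 s) (at s)" if "s > 0" for s
    by (rule DERIV_chain2[OF smooth_on_has_deriv(1)[OF G] R[OF that]]) simp
  have G1R: "((\<lambda>s. deriv G (rho_bar_unif \<rho> s)) has_real_derivative
      (deriv ^^ 2) G (rho_bar_unif \<rho> s) * R1 s) (at s)" if "s > 0" for s
    by (rule DERIV_chain2[OF smooth_on_has_deriv(2)[OF G] R[OF that]]) simp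
  have W: "(density_cv \<phi> \<rho> G has_real_derivative W1 s) (at s)" if "s > 0" for s
    unfolding density_cv_def[abs_def] W1_def
    using that by (intro DERIV_add GR double smooth_on_has_deriv(1)[OF \<phi>]) auto
  have W1: "(W1 has_real_derivative A_coeff \<phi> \<rho> G F) (at F)"
  proof -
    have "(W1 has_real_derivative
        ((deriv ^^ 2) G (rho_bar_unif \<rho> F) * R1 F * R1 F
          + (2 * (deriv ^^ 2) \<rho> F + 8 * (deriv ^^ 2) \<rho> (2 * F)) * deriv G (rho_bar_unif \<rho> F))
        + (deriv ^^ 2) \<phi> F + 2 * (2 * (deriv ^^ 2) \<phi> (2 * F))) (at F)"
      unfolding W1_def[abs_def] using \<open>F > 0\<close>
      by (intro DERIV_add DERIV_mult DERIV_cmult G1R R1 double smooth_on_has_deriv(2)[OF \<phi>]) auto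
    \<comment> \<open>The first term of \<open>A_coeff\<close> appears because \<open>R1 F\<close>
      is twice \<open>deriv \<rho> F + 2 * deriv \<rho> (2 * F)\<close>, whence the factor 4 after
      squaring.\<close>
    then show ?thesis
      by (rule DERIV_cong) (simp add: A_coeff_def R1_def power2_eq_square algebra_simps)
  qed
  have per: "u (l + 2 * int N) = u l" for l
    using assms(6) by (simp add: displacements_def)
  show ?thesis
    unfolding second_variation_def energy_cv_y_unif_add[of N u, OF assms(5) per]
    by (rule deriv2_sum_affine[of _ "{0<..}" F _ W1]) (use W W1 assms(4) in auto)
qed

lemma displacement_eq_0_if_bdiff_eq_0:
  assumes "N \<ge> 1" "u \<in> displacements N"
    and "\<And>l. l \<in> {- int N + 1..int N} \<Longrightarrow> bdiff N u l = 0"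
  shows "u = (\<lambda>_. 0)"
proof -
  have per: "u (l + 2 * int N) = u l" for l
    using assms(2) by (simp add: displacements_def)
  have diff0: "u l = u (l - 1)" if "l \<in> {- int N + 1..int N}" for l
    using assms(3)[OF that] assms(1) by (simp add: bdiff_def eps_def)
  \<comment> \<open>The induction starts one site left of the window, since the first difference
    reaches back to \<open>- int N\<close>. The upper bound stays inside the claim so that it is
    available at each step.\<close>
  have const_aux: "l \<le> int N \<longrightarrow> u l = u (- int N)" if "- int N \<le> l" for l
    using that
  proof (induction rule: int_ge_induct)
    case (step l)
    then show ?case
      using diff0[of "l + 1"] by simp
  qed simp
  have const: "u l = u (- int N)" if "l \<in> {- int N + 1..int N}" for l
    using const_aux[of l] that by simp
  have "(\<Sum>l = - int N + 1..int N. u l) = 2 * real N * u (- int N)"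
    by (subst sum.cong[OF refl const]) auto
  then have "u (- int N) = 0"
    using assms(1,2) by (simp add: displacements_def)
  then have zero: "u l = 0" if "l \<in> {- int N + 1..int N}" for l
    using const that by simp
  have per_nat: "u (l + int k * (2 * int N)) = u l" for l k
  proof (induction k)
    case (Suc k)
    then show ?case
      using per[of "l + int k * (2 * int N)"] by (simp add: algebra_simps)
  qed simp
  have "u (l + m * (2 * int N)) = u l" for l m
  proof (cases "m \<ge> 0")
    case True
    then show ?thesis
      using per_nat[of l "nat m"] by simp
  next
    case False
    then show ?thesis
      \<comment> \<open>For negative \<open>m\<close>, start from the shifted point and move forward
        to \<open>l\<close>.\<close>
      using per_nat[of "l + m * (2 * int N)" "nat (- m)"] by simp
  qed
  moreover have "\<exists>m. l + m * (2 * int N) \<in> {- int N + 1..int N}" for l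
  proof -
    \<comment> \<open>Adding \<open>N - 1\<close> carries the window onto the remainders 0 to
      \<open>2 * N - 1\<close>, so moving back by \<open>q\<close> periods lands in it.\<close>
    define q r where "q = (l + int N - 1) div (2 * int N)" and "r = (l + int N - 1) mod (2 * int N)"
    have "l + int N - 1 = q * (2 * int N) + r"
      unfolding q_def r_def by (rule div_mult_mod_eq[symmetric])
    moreover have "0 \<le> r" "r < 2 * int N"
      using assms(1) by (auto simp: r_def)
    ultimately have "l + (- q) * (2 * int N) \<in> {- int N + 1..int N}"
      unfolding atLeastAtMost_iff mult_minus_left by linarith
    then show ?thesis ..
  qed
  ultimately have "u l = 0" for l
    using zero by metis
  then show ?thesis
    by blast
qed

text \<open>A shift by one site negates the sequence but preserves its sum over a period, so that
  sum is zero.\<close>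

lemma alternating_in_displacements:
  "(\<lambda>l. if even l then 1 else - 1) \<in> displacements N"
proof -
  define u :: "int \<Rightarrow> real" where "u l = (if even l then 1 else - 1)" for l
  have "u (l + 2 * int N) = u l" "u (l + 1) = - u l" for l
    by (auto simp: u_def)
  then have "u \<in> displacements N"
    using sum_period_shift[of u N] by (simp add: displacements_def sum_negf)
  then show ?thesis
    by (simp add: u_def[abs_def])
qed

theorem theorem4p3:
  fixes \<phi> \<rho> G :: "real \<Rightarrow> real" and F :: real and N :: nat
  assumes "smooth_on {0<..} \<phi>" and "smooth_on {0<..} \<rho>" and "smooth_on UNIV G"
    and "F > 0" and "N \<ge> 1"
    and "(deriv ^^ 2) \<phi> F > 0" and "(deriv ^^ 2) \<phi> (2 * F) < 0"
    and "deriv \<rho> F \<le> 0" and "deriv \<rho> (2 * F) \<le> 0"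
    and "(deriv ^^ 2) \<rho> F \<ge> 0" and "(deriv ^^ 2) \<rho> (2 * F) \<ge> 0"
    and "(deriv ^^ 2) G (rho_bar_unif \<rho> F) \<ge> 0"
  shows "(\<forall>u \<in> displacements N - {\<lambda>_. 0}.
            second_variation (energy_cv \<phi> \<rho> G N) (y_unif N F) u > 0)
         \<longleftrightarrow> A_coeff \<phi> \<rho> G F > 0"
proof -
  \<comment> \<open>The equivalence holds for each nonzero displacement separately, because the
    other two factors of the second variation are positive.\<close>
  have "second_variation (energy_cv \<phi> \<rho> G N) (y_unif N F) u > 0 \<longleftrightarrow> A_coeff \<phi> \<rho> G F > 0"
    if u: "u \<in> displacements N - {\<lambda>_. 0}" for u
  proof -
    obtain l where "l \<in> {- int N + 1..int N}" "bdiff N u l \<noteq> 0"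
      using displacement_eq_0_if_bdiff_eq_0[of N u] assms(5) u by blast
    then have "(\<Sum>l = - int N + 1..int N. (bdiff N u l)\<^sup>2) > 0"
      by (intro sum_pos2[of _ l]) auto
    moreover have "eps N > 0"
      using assms(5) by (simp add: eps_def)
    ultimately show ?thesis
      using second_variation_energy_cv[OF assms(1-5), of u] u
      by (simp add: zero_less_mult_iff)
  qed
  \<comment> \<open>Without a nonzero displacement stability would be vacuous and could not force
    \<open>A_coeff\<close> to be positive.\<close>
  moreover have "displacements N - {\<lambda>_. 0} \<noteq> {}"
  proof -
    have "(\<lambda>l :: int. if even l then 1 else - 1 :: real) \<noteq> (\<lambda>_. 0)"
      by (auto dest: fun_cong[of _ _ 0])
    then show ?thesis
      using alternating_in_displacements[of N] by blast
  qed
  ultimately show ?thesis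
    by blast
qed

end
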